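(* Let $\alpha>1$. (a) If $\mathbf E N^{1+\alpha}<\infty$ and $\mathbf P(X_1=t)\sim a t^{-\alpha}$ as $t\to+\infty$ for some constant $a>0$, then $\mathbf P(S_N=t)\sim(\mathbf E N)\,\mathbf P(X_1=t)$ as $t\to+\infty$ through the integers. (b) If $\mathbf E N^{\beta}<\infty$ for some $\beta>1+\alpha$ and $\mathbf P(X_1=t)=t^{-\alpha}L_1(t)$ for $t=1,2,\dots$, where $L_1$ is slowly varying at infinity, then $\mathbf P(S_N=t)\sim(\mathbf E N)\,\mathbf P(X_1=t)$ as $t\to+\infty$ through the integers.
   Context: $X_1,X_2,\dots$ are i.i.d. integer valued random variables (not necessarily non-negative); $N$ is a non-negative integer valued random variable independent of $\{X_i\}$; $S_N=X_1+\dots+X_N$ (with $S_0=0$). $f(t)\sim g(t)$ means $f(t)/g(t)\to1$ as $t\to+\infty$. *)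

theory Defs
  imports "HOL-Probability.Probability" "HOL-Library.Landau_Symbols"
begin

text \<open>
  Slow variation at infinity in the sense of Karamata. Only the behaviour on a neighbourhood
  of infinity matters, so positivity and (Lebesgue) measurability are required just there.
\<close>

definition slowly_varying :: "(real \<Rightarrow> real) \<Rightarrow> bool" where
  "slowly_varying L \<longleftrightarrow>
     (\<exists>A. L \<in> borel_measurable (lebesgue_on {A..}) \<and> (\<forall>x\<ge>A. L x > 0)) \<and>
     (\<forall>c>0. ((\<lambda>x. L (c * x) / L x) \<longlongrightarrow> 1) at_top)"

text \<open>
  \<open>X i\<close> is used for \<open>i \<ge> 1\<close> only. The last conjunct says that \<open>N\<close> is independent of the
  sequence as a whole: the sigma-algebra generated by \<open>N\<close> is independent of the one generated by
  the random element \<open>(X 1, X 2, \<dots>)\<close>. The library's \<open>indep_var\<close> is not applicable because it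
  forces both random variables to have the same codomain type.
\<close>

definition iid_with_independent_index ::
    "'a measure \<Rightarrow> (nat \<Rightarrow> 'a \<Rightarrow> int) \<Rightarrow> ('a \<Rightarrow> nat) \<Rightarrow> bool" where
  "iid_with_independent_index M X N \<longleftrightarrow>
     prob_space.indep_vars M (\<lambda>_. count_space UNIV) X {1..} \<and>
     (\<forall>i\<ge>1. distr M (count_space UNIV) (X i) = distr M (count_space UNIV) (X 1)) \<and>
     N \<in> measurable M (count_space UNIV) \<and>
     prob_space.indep_set M
       (sets (vimage_algebra (space M) N (count_space UNIV)))
       (sets (vimage_algebra (space M) (\<lambda>\<omega>. \<lambda>i\<in>{1..}. X i \<omega>)
          (Pi\<^sub>M {1..} (\<lambda>_. count_space UNIV))))"

definition random_sum :: "(nat \<Rightarrow> 'a \<Rightarrow> int) \<Rightarrow> ('a \<Rightarrow> nat) \<Rightarrow> 'a \<Rightarrow> int" where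
  "random_sum X N \<omega> = (\<Sum>i=1..N \<omega>. X i \<omega>)"

text \<open>
  Asymptotic equivalence is \<^const>\<open>asymp_equiv\<close>. It is convergence of the quotient to 1, except
  that 0/0 counts as 1; for the relations considered here the latter can only matter in the
  degenerate case \<open>E N = 0\<close>.
\<close>

end

theory Submission
  imports Defs "HOL-Real_Asymp.Real_Asymp"
begin

text \<open>
  Write \<open>p\<close> for the law of \<open>X 1\<close> and \<open>p\<^bsup>n\<^esup>\<close> for its \<open>n\<close>-fold convolution power, so that
  \<open>P(S\<^sub>N = t)\<close> is the expectation of \<open>p\<^bsup>N\<^esup>(t)\<close>. The ratio \<open>p\<^bsup>n\<^esup>(t) / p(t)\<close> tends to \<open>n\<close> for
  each \<open>n\<close>, because \<open>p(t - k) / p(t)\<close> tends to 1 and \<open>p\<close> is comparable at arguments of comparable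
  size. If \<open>S\<^sub>n = t\<close>, then some summand is at least \<open>t / n\<close>; hence \<open>p\<^bsup>n\<^esup>(t)\<close> is at most \<open>n\<close> times
  the supremum of \<open>p\<close> on \<open>[t / n, \<infinity>)\<close>, which a Potter bound with exponent \<open>\<gamma>\<close> estimates by a constant
  times \<open>n\<^bsup>\<gamma>\<^esup> p(t)\<close>. So \<open>N\<^bsup>1 + \<gamma>\<^esup>\<close> dominates the ratios up to a constant, and the limit may be taken
  inside the expectation. In (a) one can take \<open>\<gamma> = \<alpha>\<close>. In (b) Potter's bounds, a consequence of the
  uniform convergence theorem for slowly varying functions, allow every \<open>\<gamma> > \<alpha>\<close>.
\<close>

section \<open>Convolution of laws on the integers\<close>

definition conv_pmf :: "int pmf \<Rightarrow> int pmf \<Rightarrow> int pmf" where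
  "conv_pmf p q = map_pmf (\<lambda>(x, y). x + y) (pair_pmf p q)"

primrec conv_pow :: "int pmf \<Rightarrow> nat \<Rightarrow> int pmf" where
  "conv_pow p 0 = return_pmf 0"
| "conv_pow p (Suc n) = conv_pmf p (conv_pow p n)"

lemma prob_pair_pmf:
  "measure (pair_pmf p q) A = (\<integral>x. measure q {y. (x, y) \<in> A} \<partial>measure_pmf p)"
proof -
  have "ennreal (measure (pair_pmf p q) A) = (\<integral>\<^sup>+z. indicator A z \<partial>pair_pmf p q)"
    by (simp add: measure_pmf.emeasure_eq_measure)
  also have "\<dots> = (\<integral>\<^sup>+x. \<integral>\<^sup>+y. indicator {y. (x, y) \<in> A} y \<partial>measure_pmf q \<partial>measure_pmf p)"
    unfolding nn_integral_pair_pmf' by (intro nn_integral_cong) (auto simp: indicator_def)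
  also have "\<dots> = (\<integral>\<^sup>+x. ennreal (measure q {y. (x, y) \<in> A}) \<partial>measure_pmf p)"
    by (simp add: measure_pmf.emeasure_eq_measure)
  also have "\<dots> = ennreal (\<integral>x. measure q {y. (x, y) \<in> A} \<partial>measure_pmf p)"
    by (intro nn_integral_eq_integral measure_pmf.integrable_const_bound[where B=1]) auto
  finally show ?thesis by (simp add: integral_nonneg_AE)
qed

lemma prob_pair_pmf_sum_eq:
  fixes p q :: "int pmf"
  shows "measure (pair_pmf p q) {(x, y). x + y = t \<and> x \<in> B}
    = (\<integral>x. indicator B x * pmf q (t - x) \<partial>measure_pmf p)"
proof -
  have "measure q {y. x + y = t \<and> x \<in> B} = indicator B x * pmf q (t - x)" for x
  proof -
    have "{y. x + y = t \<and> x \<in> B} = (if x \<in> B then {t - x} else {})" by auto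
    then show ?thesis by (simp add: pmf.rep_eq)
  qed
  then show ?thesis unfolding prob_pair_pmf by simp
qed

lemma prob_pair_pmf_sum_eq':
  fixes p q :: "int pmf"
  shows "measure (pair_pmf p q) {(x, y). x + y = t \<and> y \<in> B}
    = (\<integral>y. indicator B y * pmf p (t - y) \<partial>measure_pmf q)"
proof -
  have "measure (pair_pmf p q) {(x, y). x + y = t \<and> y \<in> B}
      = measure (pair_pmf q p) {(y, x). y + x = t \<and> y \<in> B}"
    by (subst pair_commute_pmf) (auto simp: vimage_def case_prod_unfold add.commute intro!: arg_cong2[where f=measure])
  then show ?thesis by (simp add: prob_pair_pmf_sum_eq)
qed

lemma pmf_conv_pmf: "pmf (conv_pmf p q) t = measure (pair_pmf p q) {(x, y). x + y = t}"
  by (simp add: conv_pmf_def pmf_map vimage_def case_prod_unfold)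

lemma pmf_conv_pmf_integral: "pmf (conv_pmf p q) t = (\<integral>x. pmf q (t - x) \<partial>measure_pmf p)"
  using prob_pair_pmf_sum_eq[of p q t UNIV] by (simp add: pmf_conv_pmf)

text \<open>If \<open>x + y = t\<close>, then either \<open>y \<le> h\<close> or \<open>x < t - h\<close>; with \<open>h\<close> about \<open>t / 2\<close> the other summand is large.\<close>

lemma pmf_conv_pmf_split:
  "pmf (conv_pmf p q) t
    = (\<integral>y. indicator {..h} y * pmf p (t - y) \<partial>measure_pmf q)
      + (\<integral>x. indicator {..<t - h} x * pmf q (t - x) \<partial>measure_pmf p)"
proof -
  have "{(x, y). x + y = t} = {(x, y). x + y = t \<and> y \<in> {..h}} \<union> {(x, y). x + y = t \<and> x \<in> {..<t - h}}"
    by auto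
  then have "pmf (conv_pmf p q) t = measure (pair_pmf p q) {(x, y). x + y = t \<and> y \<in> {..h}}
      + measure (pair_pmf p q) {(x, y). x + y = t \<and> x \<in> {..<t - h}}"
    unfolding pmf_conv_pmf by (simp only:) (rule measure_pmf.finite_measure_Union, auto)
  then show ?thesis
    unfolding prob_pair_pmf_sum_eq prob_pair_pmf_sum_eq' .
qed

section \<open>Limits and dominated convergence along the integers\<close>

lemma filterlim_at_top_int_iff:
  "filterlim f F (at_top :: int filter) \<longleftrightarrow> filterlim (\<lambda>n. f (int n)) F sequentially"
  using filterlim_int_of_nat_at_topD[of f F] filterlim_compose[OF _ filterlim_int_sequentially, of f F]
  by blast

lemma filterlim_int_shift: "filterlim (\<lambda>t::int. t - k) at_top at_top"
  unfolding filterlim_at_top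
  by (metis (no_types, lifting) eventually_at_top_linorder le_diff_eq)

lemma dominated_convergence_at_top_int:
  fixes s :: "int \<Rightarrow> 'b \<Rightarrow> real"
  assumes "f \<in> borel_measurable M" "\<And>t. s t \<in> borel_measurable M" "integrable M w"
    and lim: "\<And>x. x \<in> space M \<Longrightarrow> ((\<lambda>t. s t x) \<longlongrightarrow> f x) at_top"
    and bound: "\<And>t x. t \<ge> T \<Longrightarrow> x \<in> space M \<Longrightarrow> \<bar>s t x\<bar> \<le> w x"
  shows "((\<lambda>t. \<integral>x. s t x \<partial>M) \<longlongrightarrow> (\<integral>x. f x \<partial>M)) at_top"
  unfolding filterlim_at_top_int_iff
\<comment> \<open>The domination starts only at \<open>T\<close>, so the sequence is shifted by
  \<open>nat T\<close>, which is at least \<open>T\<close> for negative \<open>T\<close>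
  too.\<close>
proof (rule LIMSEQ_offset[where k="nat T"], rule integral_dominated_convergence[OF assms(1) _ assms(3)])
  show "AE x in M. (\<lambda>n. s (int (n + nat T)) x) \<longlonglongrightarrow> f x"
    using lim[unfolded filterlim_at_top_int_iff, THEN LIMSEQ_ignore_initial_segment, of _ "nat T"]
    by (intro AE_I2) auto
  show "AE x in M. norm (s (int (n + nat T)) x) \<le> w x" for n
    using bound by (intro AE_I2) auto
qed (use assms(2) in auto)

text \<open>A sum of \<open>n\<close> terms that reaches \<open>n * x\<close> has a term that
  reaches \<open>x\<close>. The induction peels off one summand: either the rest stays below
  \<open>n * x\<close>, and then the peeled summand exceeds \<open>x\<close>, which costs at most
  \<open>B\<close>; or the rest reaches \<open>n * x\<close>, and the induction hypothesis gives
  \<open>n * B\<close>.\<close>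

lemma pmf_conv_pow_le:
  assumes B: "\<And>k::int. x \<le> real_of_int k \<Longrightarrow> pmf p k \<le> B" and "n > 0" "real n * x \<le> real_of_int t"
  shows "pmf (conv_pow p n) t \<le> real n * B"
  using assms(2,3)
proof (induction n arbitrary: t rule: nat_induct_non_zero)
  case 1
  then show ?case
    using B[of t] by (simp add: conv_pmf_def pair_return_pmf2 map_pmf_comp)
next
  case (Suc n)
  let ?q = "conv_pow p n"
  \<comment> \<open>The integers below \<open>real n * x\<close> are exactly those up to
    \<open>k - 1\<close>, so a cut at \<open>k - 1\<close> separates the two cases.\<close>
  define k where "k = \<lceil>real n * x\<rceil>"
  have B0: "0 \<le> B" using B[of "\<lceil>x\<rceil>"] by (simp add: order_trans[OF pmf_nonneg])
  have "pmf (conv_pow p (Suc n)) t = (\<integral>y. indicator {..k-1} y * pmf p (t - y) \<partial>measure_pmf ?q)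
      + (\<integral>y. indicator {..<t - (k-1)} y * pmf ?q (t - y) \<partial>measure_pmf p)"
    by (simp add: pmf_conv_pmf_split[of p ?q t "k-1"])
  also have "(\<integral>y. indicator {..k-1} y * pmf p (t - y) \<partial>measure_pmf ?q) \<le> (\<integral>y. B \<partial>measure_pmf ?q)"
  proof (rule integral_mono)
    fix y
    show "indicator {..k-1} y * pmf p (t - y) \<le> B"
    proof (cases "y \<le> k - 1")
      case True
      then have "real_of_int y < real n * x" unfolding k_def by linarith
      then have "x \<le> real_of_int (t - y)" using Suc.prems by (simp add: algebra_simps)
      then show ?thesis using B B0 True by simp
    qed (use B0 in simp)
  qed (auto intro!: measure_pmf.integrable_const_bound[where B=1] simp: pmf_le_1 indicator_def)
  also have "(\<integral>y. indicator {..<t - (k-1)} y * pmf ?q (t - y) \<partial>measure_pmf p) \<le> (\<integral>y. real n * B \<partial>measure_pmf p)"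
  proof (rule integral_mono)
    fix y
    show "indicator {..<t - (k-1)} y * pmf ?q (t - y) \<le> real n * B"
    proof (cases "y < t - (k - 1)")
      case True
      then have "t - y \<ge> k" by simp
      then have "real n * x \<le> real_of_int (t - y)" unfolding k_def by linarith
      then show ?thesis using Suc.IH True by simp
    qed (use B0 in simp)
  qed (auto intro!: measure_pmf.integrable_const_bound[where B=1] simp: pmf_le_1 indicator_def)
  finally show ?case by (simp add: algebra_simps)
qed

section \<open>Convolution powers of laws with a regular tail\<close>

text \<open>The common ground of (a) and (b). For \<open>k \<ge> t\<close> the \<open>max 1\<close>
  turns \<open>tail_le\<close> into monotonicity up to the factor \<open>C\<close>; for
  \<open>k < t\<close> it allows a polynomial loss of order \<gamma>.\<close>

locale regular_tail =
  fixes p :: "int pmf" and K :: int and C \<gamma> :: real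
  assumes K_pos: "K > 0" and \<gamma>_nonneg: "\<gamma> \<ge> 0"
    and tail_pos: "\<And>t. K \<le> t \<Longrightarrow> pmf p t > 0"
    and tail_le: "\<And>k t. K \<le> k \<Longrightarrow> K \<le> t \<Longrightarrow>
        pmf p k \<le> C * max 1 (real_of_int t / real_of_int k) powr \<gamma> * pmf p t"
    and long_tail: "\<And>k. ((\<lambda>t. pmf p (t - k) / pmf p t) \<longlongrightarrow> 1) at_top"
begin

lemma C_ge_1: "1 \<le> C"
  using tail_le[of K K] tail_pos[of K] K_pos by simp

lemma tail_le_of_ratio_le:
  assumes "K \<le> k" "K \<le> t" "real_of_int t \<le> c * real_of_int k" "1 \<le> c"
  shows "pmf p k \<le> C * c powr \<gamma> * pmf p t"
proof -
  have "max 1 (real_of_int t / real_of_int k) \<le> c"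
    using assms K_pos by (simp add: field_simps)
  then have "max 1 (real_of_int t / real_of_int k) powr \<gamma> \<le> c powr \<gamma>"
    using \<gamma>_nonneg by (intro powr_mono2) auto
  then have "C * max 1 (real_of_int t / real_of_int k) powr \<gamma> * pmf p t \<le> C * c powr \<gamma> * pmf p t"
    using C_ge_1 by (intro mult_right_mono mult_left_mono) auto
  then show ?thesis using tail_le[OF assms(1,2)] by linarith
qed

text \<open>One big jump: if \<open>x + y = t\<close> is large, then either \<open>x\<close> is
  large and \<open>y\<close> stays bounded, which contributes 1, or the roles are exchanged, which
  contributes \<open>c\<close>. After a cut at \<open>t div 2\<close> the large summand is at least
  \<open>t / 2\<close>, so both parts are dominated by constants and the limits pass through the
  integrals.\<close>

lemma conv_pmf_tendsto:
  assumes q: "((\<lambda>t. pmf q t / pmf p t) \<longlongrightarrow> c) at_top"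
  shows "((\<lambda>t. pmf (conv_pmf p q) t / pmf p t) \<longlongrightarrow> 1 + c) at_top"
proof -
  \<comment> \<open>The cost of replacing \<open>t - y\<close> by \<open>t\<close> when
    \<open>t - y\<close> is at least \<open>t / 2\<close>: the quotient of the arguments is then at
    most 2.\<close>
  define D where "D = C * 2 powr \<gamma>"
  have D: "0 \<le> D" using C_ge_1 by (simp add: D_def)
  have half: "pmf p (t - y) \<le> D * pmf p t" if "2 * K \<le> t" "2 * y \<le> t" for t y
    unfolding D_def using that K_pos by (intro tail_le_of_ratio_le) auto
  have lim_half: "eventually (\<lambda>t. y \<le> t div 2) at_top" for y :: int
    using eventually_ge_at_top[of "2 * y"] by eventually_elim auto
  have lim_half': "eventually (\<lambda>t. y < t - t div 2) at_top" for y :: int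
    using eventually_ge_at_top[of "2 * y + 2"] by eventually_elim auto
  \<comment> \<open>From some \<open>T\<close> on, \<open>q\<close> is at most a constant multiple
    of \<open>p\<close>, so bounds for \<open>p\<close> carry over to \<open>q\<close>.\<close>
  have "eventually (\<lambda>t. pmf q t / pmf p t < \<bar>c\<bar> + 1) at_top"
    by (rule order_tendstoD[OF q]) simp
  then obtain T0 where T0: "\<And>t. T0 \<le> t \<Longrightarrow> pmf q t / pmf p t < \<bar>c\<bar> + 1"
    unfolding eventually_at_top_linorder by blast
  define T where "T = max T0 K"
  have T: "pmf q t \<le> (\<bar>c\<bar> + 1) * pmf p t" if "T \<le> t" for t
    using T0[of t] tail_pos[of t] that by (simp add: T_def field_simps)
  have q_shift: "((\<lambda>t. pmf q (t - x) / pmf p t) \<longlongrightarrow> c) at_top" for x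
  proof -
    from tendsto_mult[OF filterlim_compose[OF q filterlim_int_shift[of x]] long_tail[of x]]
    have lim: "((\<lambda>t. pmf q (t - x) / pmf p (t - x) * (pmf p (t - x) / pmf p t)) \<longlongrightarrow> c) at_top"
      by simp
    have "eventually (\<lambda>t. pmf q (t - x) / pmf p (t - x) * (pmf p (t - x) / pmf p t)
        = pmf q (t - x) / pmf p t) at_top"
      using eventually_ge_at_top[of "K + x"]
    proof eventually_elim
      case (elim t)
      then show ?case using tail_pos[of "t - x"] by simp
    qed
    from Lim_transform_eventually[OF lim this] show ?thesis .
  qed
  have 1: "((\<lambda>t. \<integral>y. indicator {..t div 2} y * pmf p (t - y) / pmf p t \<partial>measure_pmf q)
      \<longlongrightarrow> (\<integral>y. 1 \<partial>measure_pmf q)) at_top"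
  proof (rule dominated_convergence_at_top_int[where w="\<lambda>_. D" and T="2 * K"])
    fix y
    have "eventually (\<lambda>t. pmf p (t - y) / pmf p t
        = indicator {..t div 2} y * pmf p (t - y) / pmf p t) at_top"
      using lim_half[of y] by eventually_elim simp
    from Lim_transform_eventually[OF long_tail[of y] this]
    show "((\<lambda>t. indicator {..t div 2} y * pmf p (t - y) / pmf p t) \<longlongrightarrow> 1) at_top" .
    fix t assume t: "2 * K \<le> t"
    then have "pmf p t > 0" using tail_pos[of t] K_pos by simp
    with half[of t y] t D show "\<bar>indicator {..t div 2} y * pmf p (t - y) / pmf p t\<bar> \<le> D"
      by (auto simp: field_simps indicator_def)
  qed auto
  have 2: "((\<lambda>t. \<integral>x. indicator {..<t - t div 2} x * pmf q (t - x) / pmf p t \<partial>measure_pmf p)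
      \<longlongrightarrow> (\<integral>x. c \<partial>measure_pmf p)) at_top"
  proof (rule dominated_convergence_at_top_int[where w="\<lambda>_. (\<bar>c\<bar> + 1) * D" and T="2 * max T K"])
    fix x
    have "eventually (\<lambda>t. pmf q (t - x) / pmf p t
        = indicator {..<t - t div 2} x * pmf q (t - x) / pmf p t) at_top"
      using lim_half'[of x] by eventually_elim simp
    from Lim_transform_eventually[OF q_shift[of x] this]
    show "((\<lambda>t. indicator {..<t - t div 2} x * pmf q (t - x) / pmf p t) \<longlongrightarrow> c) at_top" .
    fix t assume t: "2 * max T K \<le> t"
    then have pos: "pmf p t > 0" using tail_pos[of t] K_pos by simp
    show "\<bar>indicator {..<t - t div 2} x * pmf q (t - x) / pmf p t\<bar> \<le> (\<bar>c\<bar> + 1) * D"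
    proof (cases "x < t - t div 2")
      case True
      \<comment> \<open>Valid for either parity of \<open>t\<close>; hence \<open>t - x\<close> is
        at least \<open>t / 2\<close>, which lies beyond \<open>T\<close>.\<close>
      then have le: "2 * x \<le> t" by presburger
      then have "T \<le> t - x" using t by linarith
      from T[OF this] half[of t x] le t
      have "pmf q (t - x) \<le> (\<bar>c\<bar> + 1) * (D * pmf p t)"
        by (smt (verit) mult_left_mono)
      then show ?thesis using pos True D by (simp add: field_simps)
    qed (use D in auto)
  qed auto
  show ?thesis
    using tendsto_add[OF 1 2]
    by (simp add: pmf_conv_pmf_split[where p=p and q=q and h="t div 2" and t=t for t] add_divide_distrib)
qed

lemma conv_pow_tendsto: "((\<lambda>t. pmf (conv_pow p n) t / pmf p t) \<longlongrightarrow> real n) at_top"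
proof (induction n)
  case 0
  \<comment> \<open>The point mass at 0 vanishes at every \<open>t > 0\<close>, so the induction
    starts with the limit 0.\<close>
  have "eventually (\<lambda>t. 0 = pmf (conv_pow p 0) t / pmf p t) at_top"
    using eventually_gt_at_top[of 0] by eventually_elim simp
  from Lim_transform_eventually[OF tendsto_const this] show ?case by simp
next
  case (Suc n)
  from conv_pmf_tendsto[OF this] show ?case by simp
qed

text \<open>Supplies the dominating function \<open>N powr (1 + \<gamma>)\<close>: one factor
  \<open>n\<close> counts the summands that may be the large one, and \<open>n powr \<gamma>\<close>
  compares \<open>p\<close> at \<open>t / n\<close> with \<open>p\<close> at \<open>t\<close>. The
  comparison requires \<open>t / n \<ge> K\<close>; smaller \<open>t\<close> are treated
  separately.\<close>

lemma conv_pow_le: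
  assumes t: "K \<le> t"
  shows "pmf (conv_pow p n) t \<le> C / pmf p K * real n powr (1 + \<gamma>) * pmf p t"
proof (cases "n = 0")
  case True
  then show ?thesis using K_pos t by simp
next
  case n: False
  have K: "0 < pmf p K" "pmf p K \<le> 1" using tail_pos by (auto simp: pmf_le_1)
  have n1: "real n * real n powr \<gamma> = real n powr (1 + \<gamma>)" using n by (simp add: powr_add)
  have CK: "C \<le> C / pmf p K" using K C_ge_1 by (simp add: field_simps)
  show ?thesis
  proof (cases "real n * real_of_int K \<le> real_of_int t")
    case True
    have "pmf p k \<le> C * real n powr \<gamma> * pmf p t" if "real_of_int t / real n \<le> real_of_int k" for k
    proof (rule tail_le_of_ratio_le)
      show nk: "real_of_int t \<le> real n * real_of_int k" using that n by (simp add: field_simps)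
      have "real n * real_of_int K \<le> real n * real_of_int k" using nk True by linarith
      then show "K \<le> k" using n by simp
    qed (use n t in auto)
    then have "pmf (conv_pow p n) t \<le> real n * (C * real n powr \<gamma> * pmf p t)"
      using n by (intro pmf_conv_pow_le) auto
    also have "\<dots> = C * (real n powr (1 + \<gamma>) * pmf p t)" by (simp add: n1[symmetric])
    also have "\<dots> \<le> C / pmf p K * (real n powr (1 + \<gamma>) * pmf p t)"
      using CK by (intro mult_right_mono) auto
    finally show ?thesis by simp
  next
    case False
    \<comment> \<open>Here \<open>t < n * K\<close>, and the trivial bound 1 for the convolution
      power suffices: comparing \<open>p\<close> at \<open>K\<close> and at \<open>t\<close> shows
      that the right-hand side is at least 1. This is the origin of the division by
      \<open>pmf p K\<close>.\<close>
    then have "pmf p K \<le> C * real n powr \<gamma> * pmf p t"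
      using n t by (intro tail_le_of_ratio_le) auto
    also have "\<dots> \<le> C * real n powr (1 + \<gamma>) * pmf p t"
      using C_ge_1 n by (intro mult_right_mono mult_left_mono powr_mono) auto
    finally have "1 \<le> C / pmf p K * real n powr (1 + \<gamma>) * pmf p t" using K by (simp add: field_simps)
    then show ?thesis using pmf_le_1[of "conv_pow p n" t] by linarith
  qed
qed

end

section \<open>Slowly varying functions: uniform convergence and Potter bounds\<close>

text \<open>A weak form of Egorov's theorem: the sets \<open>S n\<close> increase to the whole
  interval, so their measures tend to its length.\<close>

lemma eventually_measure_uniformly_small:
  fixes g :: "nat \<Rightarrow> real \<Rightarrow> real"
  assumes meas: "\<And>n. g n \<in> borel_measurable (lebesgue_on {a..b})"
    and lim: "\<And>u. u \<in> {a..b} \<Longrightarrow> (\<lambda>n. g n u) \<longlonglongrightarrow> 0" and "\<epsilon> > 0" "a \<le> b" "r < b - a"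
  defines "S \<equiv> \<lambda>n. {u \<in> {a..b}. \<forall>m\<ge>n. \<bar>g m u\<bar> < \<epsilon>}"
  shows "eventually (\<lambda>n. S n \<in> lmeasurable \<and> r < measure lebesgue (S n)) sequentially"
proof -
  let ?M = "lebesgue_on {a..b}"
  note [measurable] = meas
  have S: "S n \<in> sets ?M" for n
  proof -
    have "{u \<in> space ?M. \<forall>m\<in>{n..}. \<bar>g m u\<bar> < \<epsilon>} \<in> sets ?M" by measurable
    also have "{u \<in> space ?M. \<forall>m\<in>{n..}. \<bar>g m u\<bar> < \<epsilon>} = S n" by (auto simp: S_def)
    finally show ?thesis .
  qed
  have Un: "(\<Union>n. S n) = {a..b}"
  proof
    show "{a..b} \<subseteq> (\<Union>n. S n)"
    proof
      fix u assume u: "u \<in> {a..b}"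
      from LIMSEQ_D[OF lim[OF u] \<open>\<epsilon> > 0\<close>] u show "u \<in> (\<Union>n. S n)"
        by (auto simp: S_def)
    qed
  qed (auto simp: S_def)
  have lm: "S n \<in> lmeasurable" and eq: "measure ?M (S n) = measure lebesgue (S n)" for n
  proof -
    have sub: "S n \<subseteq> {a..b}" by (auto simp: S_def)
    have "S n \<in> sets lebesgue" using S[of n] by (simp add: sets_restrict_space_iff)
    then show "S n \<in> lmeasurable" by (intro bounded_set_imp_lmeasurable bounded_subset[OF _ sub]) auto
    show "measure ?M (S n) = measure lebesgue (S n)" using sub by (simp add: measure_restrict_space)
  qed
  have "(\<lambda>n. measure ?M (S n)) \<longlonglongrightarrow> measure ?M (\<Union>n. S n)"
  proof (rule Lim_measure_incseq)
    show "incseq S" by (auto simp: incseq_def S_def)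
    show "emeasure ?M (\<Union>n. S n) \<noteq> \<infinity>" unfolding Un using \<open>a \<le> b\<close> by (simp add: emeasure_restrict_space)
  qed (use S in auto)
  then have "(\<lambda>n. measure lebesgue (S n)) \<longlonglongrightarrow> b - a"
    using \<open>a \<le> b\<close> by (simp add: Un eq measure_restrict_space)
  from order_tendstoD(1)[OF this \<open>r < b - a\<close>] show ?thesis using lm by simp
qed

text \<open>The pigeonhole principle for Lebesgue measure; it will produce the common point in the
  uniform convergence theorem.\<close>

lemma lmeasurable_inter_nonempty:
  fixes U V :: "real set"
  assumes "U \<in> lmeasurable" "V \<in> lmeasurable" "U \<subseteq> {a..b}" "V \<subseteq> {a..b}" "a \<le> b"
    and "b - a < measure lebesgue U + measure lebesgue V"
  shows "U \<inter> V \<noteq> {}"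
proof
  assume "U \<inter> V = {}"
  then have "measure lebesgue U + measure lebesgue V = measure lebesgue (U \<union> V)"
    using assms(1,2) measure_Un3[of U lebesgue V] by simp
  also have "\<dots> \<le> measure lebesgue {a..b}"
    using assms by (intro measure_mono_fmeasurable) auto
  finally show False using assms by simp
qed

text \<open>Passing to \<open>ln (L x)\<close> makes errors additive. The threshold is raised to at
  least 1 so that all arguments beyond it are positive.\<close>

lemma slowly_varyingE:
  assumes "slowly_varying L"
  obtains A where "A > 0" "L \<in> borel_measurable (lebesgue_on {A..})" "\<And>x. A \<le> x \<Longrightarrow> L x > 0"
    and "\<And>c. c > 0 \<Longrightarrow> ((\<lambda>x. ln (L (c * x)) - ln (L x)) \<longlongrightarrow> 0) at_top"
proof -
  obtain A where A: "L \<in> borel_measurable (lebesgue_on {A..})" "\<And>x. A \<le> x \<Longrightarrow> L x > 0"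
    and lim: "\<And>c. c > 0 \<Longrightarrow> ((\<lambda>x. L (c * x) / L x) \<longlongrightarrow> 1) at_top"
    using assms unfolding slowly_varying_def by auto
  show thesis
  proof (rule that[of "max A 1"])
    show "L \<in> borel_measurable (lebesgue_on {max A 1..})"
      by (rule measurable_restrict_mono[OF A(1)]) auto
    fix c :: real assume c: "c > 0"
    have "((\<lambda>x. ln (L (c * x) / L x)) \<longlongrightarrow> ln 1) at_top"
      by (intro tendsto_ln lim c) auto
    moreover have "eventually (\<lambda>x. ln (L (c * x) / L x) = ln (L (c * x)) - ln (L x)) at_top"
      using eventually_ge_at_top[of A] eventually_ge_at_top[of "A / c"]
    proof eventually_elim
      case (elim x)
      then have "L x > 0" "L (c * x) > 0" using c by (auto intro!: A(2) simp: field_simps)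
      then show ?case by (simp add: ln_div)
    qed
    ultimately show "((\<lambda>x. ln (L (c * x)) - ln (L x)) \<longlongrightarrow> 0) at_top"
      using Lim_transform_eventually by fastforce
  qed (use A in auto)
qed

text \<open>
  If uniformity failed at points \<open>x n\<close> with factors \<open>c n\<close>, then for large \<open>n\<close> the set of \<open>u\<close>
  with \<open>L (u * x n)\<close> close to \<open>L (x n)\<close> and the \<open>c n\<close>-dilate of the set of \<open>v\<close> with
  \<open>L (v * c n * x n)\<close> close to \<open>L (c n * x n)\<close> would be too large to be disjoint.
\<close>

lemma slowly_varying_uniform:
  assumes sv: "slowly_varying L" and "\<epsilon> > 0"
  shows "\<exists>X. \<forall>x\<ge>X. \<forall>c\<in>{1..2}. \<bar>ln (L (c * x)) - ln (L x)\<bar> < \<epsilon>"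
proof (rule ccontr)
  from sv obtain A where A: "A > 0" "L \<in> borel_measurable (lebesgue_on {A..})" "\<And>x. A \<le> x \<Longrightarrow> L x > 0"
    and lim: "\<And>c. c > 0 \<Longrightarrow> ((\<lambda>x. ln (L (c * x)) - ln (L x)) \<longlongrightarrow> 0) at_top"
    by (rule slowly_varyingE) blast
  define f where "f x = ln (L x)" for x
  assume "\<not> ?thesis"
  \<comment> \<open>The counterexamples are chosen beyond \<open>A + real n\<close>, so that they
    tend to infinity while \<open>L\<close> stays positive there.\<close>
  then have "\<forall>n. \<exists>x c. A + real n \<le> x \<and> c \<in> {1..2} \<and> \<epsilon> \<le> \<bar>f (c * x) - f x\<bar>"
    unfolding f_def by (meson not_less)
  then obtain x c where x: "\<And>n. A + real n \<le> x n" and c: "\<And>n. c n \<in> {1..2}"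
    and far: "\<And>n. \<epsilon> \<le> \<bar>f (c n * x n) - f (x n)\<bar>"
    by metis
  \<comment> \<open>The window \<open>{1..4}\<close> has length 3, of which \<open>E y n\<close>
    eventually fills more than 5/2. This is enough: \<open>E\<close> along \<open>x\<close> and the
    dilate by \<open>c\<close> of \<open>E\<close> along \<open>c * x\<close> both lie in
    \<open>{1..4 * c}\<close>, and \<open>5/2 + c * 5/2 > 4 * c - 1\<close> for
    \<open>c \<le> 2\<close>.\<close>
  define E where "E y n = {u \<in> {1..4}. \<forall>m\<ge>n. \<bar>f (u * y m) - f (y m)\<bar> < \<epsilon> / 2}"
    for y :: "nat \<Rightarrow> real" and n
  have E: "eventually (\<lambda>n. E y n \<in> lmeasurable \<and> 5 / 2 < measure lebesgue (E y n)) sequentially"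
    if y: "\<And>n. A + real n \<le> y n" for y
    unfolding E_def
  proof (rule eventually_measure_uniformly_small)
    fix n
    have yA: "A \<le> y n" using y[of n] by simp
    have "(\<lambda>u. u * y n) \<in> lebesgue_on {1..4} \<rightarrow>\<^sub>M lebesgue_on {A..}"
    proof (rule measurable_restrict_space3)
      have scale_eq: "(*\<^sub>R) (y n) = (\<lambda>u. u * y n)" by (auto simp: fun_eq_iff)
      show "(\<lambda>u. u * y n) \<in> lebesgue \<rightarrow>\<^sub>M lebesgue"
        unfolding scale_eq[symmetric] by (rule lebesgue_measurable_scaling)
      have "A \<le> u * y n" if "1 \<le> u" for u
        using that yA \<open>A > 0\<close> mult_right_mono[of 1 u "y n"] by linarith
      then show "(\<lambda>u. u * y n) \<in> {1..4} \<rightarrow> {A..}" by auto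
    qed
    from measurable_compose[OF this A(2)]
    show "(\<lambda>u. f (u * y n) - f (y n)) \<in> borel_measurable (lebesgue_on {1..4})"
      unfolding f_def by measurable
  next
    fix u :: real assume u: "u \<in> {1..4}"
    have "filterlim y at_top sequentially"
    proof (rule filterlim_at_top_mono[OF filterlim_real_sequentially always_eventually], rule allI)
      show "real n \<le> y n" for n using y[of n] A(1) by linarith
    qed
    from filterlim_compose[OF lim this] u
    show "(\<lambda>n. f (u * y n) - f (y n)) \<longlonglongrightarrow> 0" by (simp add: f_def)
  qed (use \<open>\<epsilon> > 0\<close> in auto)
  have cx: "A + real n \<le> c n * x n" for n
    using x[of n] c[of n] A(1) mult_right_mono[of 1 "c n" "x n"] unfolding atLeastAtMost_iff by linarith
  obtain n where U: "E x n \<in> lmeasurable" "5 / 2 < measure lebesgue (E x n)"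
    and V: "E (\<lambda>n. c n * x n) n \<in> lmeasurable" "5 / 2 < measure lebesgue (E (\<lambda>n. c n * x n) n)"
    using eventually_happens'[OF _ eventually_conj[OF E[OF x] E[OF cx]]] by auto
  let ?V = "(*) (c n) ` E (\<lambda>n. c n * x n) n"
  have "E x n \<inter> ?V \<noteq> {}"
  proof (rule lmeasurable_inter_nonempty[where a=1 and b="4 * c n"])
    show V_sub: "?V \<subseteq> {1..4 * c n}"
    proof
      fix w assume "w \<in> ?V"
      then obtain v where "w = c n * v" "1 \<le> v" "v \<le> 4" by (auto simp: E_def)
      then show "w \<in> {1..4 * c n}" using c[of n] mult_mono[of 1 "c n" 1 v] by simp
    qed
    have "?V = (*\<^sub>R) (1 / c n) -` E (\<lambda>n. c n * x n) n \<inter> space lebesgue"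
      using c[of n] by (force simp: image_iff)
    also have "\<dots> \<in> sets lebesgue"
      using V(1) by (intro measurable_sets[OF lebesgue_measurable_scaling]) (rule fmeasurableD)
    finally show "?V \<in> lmeasurable"
      by (intro bounded_set_imp_lmeasurable bounded_subset[OF _ V_sub]) auto
    have "measure lebesgue ?V = c n * measure lebesgue (E (\<lambda>n. c n * x n) n)"
      using measure_lebesgue_affine[of "c n" "0 :: real"] c[of n] by simp
    moreover have "c n * (5 / 2) < c n * measure lebesgue (E (\<lambda>n. c n * x n) n)"
      using V(2) c[of n] by (intro mult_strict_left_mono) auto
    ultimately show "4 * c n - 1 < measure lebesgue (E x n) + measure lebesgue ?V"
      using U(2) c[of n] unfolding atLeastAtMost_iff by linarith
    show "E x n \<subseteq> {1..4 * c n}" using c[of n] unfolding E_def by auto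
    show "1 \<le> 4 * c n" using c[of n] by simp
  qed (rule U(1))
  \<comment> \<open>At the common point, \<open>f (x n)\<close> and \<open>f (c n * x n)\<close> are
    both within \<epsilon>/2 of one and the same value, against \<open>far\<close>.\<close>
  then obtain v where "c n * v \<in> E x n" "v \<in> E (\<lambda>n. c n * x n) n" by auto
  then have "\<bar>f (c n * v * x n) - f (x n)\<bar> < \<epsilon> / 2" "\<bar>f (v * (c n * x n)) - f (c n * x n)\<bar> < \<epsilon> / 2"
    by (auto simp: E_def)
  moreover have "c n * v * x n = v * (c n * x n)" by simp
  ultimately show False using far[of n] by argo
qed

text \<open>By uniform convergence, far out each doubling of the argument changes
  \<open>ln L\<close> by less than \<open>\<delta> * ln 2\<close>. Going from \<open>x\<close> to
  \<open>y\<close> takes at most \<open>log 2 (y / x)\<close> full doublings and one incomplete one;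
  the factor 2 inside the logarithm pays for the latter.\<close>

lemma slowly_varying_potter:
  assumes sv: "slowly_varying L" and "\<delta> > 0"
  obtains X where "X > 0" "\<And>x. X \<le> x \<Longrightarrow> L x > 0"
    and "\<And>x y. X \<le> x \<Longrightarrow> x \<le> y \<Longrightarrow> \<bar>ln (L y) - ln (L x)\<bar> \<le> \<delta> * ln (2 * y / x)"
proof -
  obtain A where A: "A > 0" "\<And>x. A \<le> x \<Longrightarrow> L x > 0"
    using sv by (rule slowly_varyingE) blast
  obtain X0 where X0: "\<And>x c. X0 \<le> x \<Longrightarrow> c \<in> {1..2} \<Longrightarrow> \<bar>ln (L (c * x)) - ln (L x)\<bar> < \<delta> * ln 2"
    using slowly_varying_uniform[OF sv, of "\<delta> * ln 2"] \<open>\<delta> > 0\<close>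
    by (metis ln_gt_zero mult_pos_pos one_less_numeral_iff semiring_norm(76))
  define X where "X = max A X0"
  show thesis
  proof (rule that[of X])
    fix x y assume x: "X \<le> x" and xy: "x \<le> y"
    have x0: "x > 0" using x A by (simp add: X_def)
    obtain m where "y / x < 2 ^ m" using real_arch_pow[of 2 "y / x"] by auto
    then have "y \<le> 2 ^ m * x" using x0 by (simp add: field_simps)
    then show "\<bar>ln (L y) - ln (L x)\<bar> \<le> \<delta> * ln (2 * y / x)"
      using xy
    proof (induction m arbitrary: y)
      case 0
      then show ?case using x0 \<open>\<delta> > 0\<close> by simp
    next
      case (Suc m)
      show ?case
      proof (cases "y \<le> 2 * x")
        case True
        have "\<bar>ln (L y) - ln (L x)\<bar> < \<delta> * ln 2"
          using X0[of x "y / x"] x x0 True Suc.prems by (simp add: X_def divide_le_eq)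
        also have "\<delta> * ln 2 \<le> \<delta> * ln (2 * y / x)"
          using x0 Suc.prems \<open>\<delta> > 0\<close> by (intro mult_left_mono) (auto simp: field_simps)
        finally show ?thesis by simp
      next
        case False
        have "\<bar>ln (L (y / 2)) - ln (L x)\<bar> \<le> \<delta> * ln (2 * (y / 2) / x)"
          using Suc.prems False by (intro Suc.IH) auto
        moreover have "\<bar>ln (L y) - ln (L (y / 2))\<bar> < \<delta> * ln 2"
          using X0[of "y / 2" 2] x False by (simp add: X_def)
        moreover have "\<delta> * ln (2 * y / x) = \<delta> * ln 2 + \<delta> * ln (2 * (y / 2) / x)"
          using x0 Suc.prems by (simp add: ln_mult ln_div algebra_simps)
        ultimately show ?thesis by argo
      qed
    qed
  qed (use A in \<open>auto simp: X_def\<close>)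
qed

text \<open>The factor \<open>(x + s) / x\<close> varies with \<open>x\<close>, so pointwise slow
  variation does not apply directly; but \<open>x\<close> and \<open>x + s\<close> eventually differ
  by a factor at most 2, and uniformity covers all such factors.\<close>

lemma slowly_varying_shift:
  assumes sv: "slowly_varying L"
  shows "((\<lambda>x. L (x + s) / L x) \<longlongrightarrow> 1) at_top"
proof -
  obtain A where A: "A > 0" "\<And>x. A \<le> x \<Longrightarrow> L x > 0"
    using sv by (rule slowly_varyingE) blast
  have "((\<lambda>x. ln (L (x + s)) - ln (L x)) \<longlongrightarrow> 0) at_top"
  proof (rule tendstoI)
    fix \<epsilon> :: real assume "\<epsilon> > 0"
    then obtain X where X: "\<And>x c. X \<le> x \<Longrightarrow> c \<in> {1..2} \<Longrightarrow> \<bar>ln (L (c * x)) - ln (L x)\<bar> < \<epsilon>"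
      using slowly_varying_uniform[OF sv] by blast
    have step: "\<bar>ln (L y) - ln (L x)\<bar> < \<epsilon>" if "X \<le> x" "0 < x" "x \<le> y" "y \<le> 2 * x" for x y
      using X[of x "y / x"] that by (simp add: divide_le_eq)
    show "eventually (\<lambda>x. dist (ln (L (x + s)) - ln (L x)) 0 < \<epsilon>) at_top"
      \<comment> \<open>Beyond this threshold the smaller of \<open>x\<close> and
        \<open>x + s\<close> is at least \<open>X\<close>, and the larger is at most twice the
        smaller, whatever the sign of \<open>s\<close>.\<close>
      using eventually_ge_at_top[of "\<bar>X\<bar> + 2 * \<bar>s\<bar> + 1"]
    proof eventually_elim
      case (elim x)
      show ?case
      proof (cases "s \<ge> 0")
        case True
        then show ?thesis using step[of x "x + s"] elim by simp
      next
        case False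
        then show ?thesis using step[of "x + s" x] elim by (simp add: abs_minus_commute)
      qed
    qed
  qed
  from tendsto_exp[OF this] have "((\<lambda>x. exp (ln (L (x + s)) - ln (L x))) \<longlongrightarrow> 1) at_top" by simp
  moreover have "eventually (\<lambda>x. exp (ln (L (x + s)) - ln (L x)) = L (x + s) / L x) at_top"
    using eventually_ge_at_top[of A] eventually_ge_at_top[of "A - s"]
  proof eventually_elim
    case (elim x)
    then show ?case using A(2)[of x] A(2)[of "x + s"] by (simp add: exp_diff)
  qed
  ultimately show ?thesis by (rule Lim_transform_eventually)
qed

section \<open>Laws of integer-valued random variables and of random sums\<close>

lemma measurable_int_add:
  fixes f g :: "'a \<Rightarrow> int"
  assumes f: "f \<in> measurable M (count_space UNIV)" and g: "g \<in> measurable M (count_space UNIV)"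
  shows "(\<lambda>x. f x + g x) \<in> measurable M (count_space UNIV)"
  by (rule measurable_compose_countable[OF _ f], rule measurable_compose[OF g]) simp

lemma measurable_int_sum:
  fixes f :: "'i \<Rightarrow> 'a \<Rightarrow> int"
  assumes "\<And>i. i \<in> I \<Longrightarrow> f i \<in> measurable M (count_space UNIV)"
  shows "(\<lambda>x. \<Sum>i\<in>I. f i x) \<in> measurable M (count_space UNIV)"
  using assms by (induction I rule: infinite_finite_induct) (auto intro!: measurable_int_add)

context prob_space
begin

definition pmf_distr :: "('a \<Rightarrow> 'b::countable) \<Rightarrow> 'b pmf" where
  "pmf_distr Y = Abs_pmf (distr M (count_space UNIV) Y)"

text \<open>On a countable type the points of measure zero form a countable union of null sets, so
  almost every point is an atom.\<close>

lemma measure_pmf_distr: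
  fixes Y :: "'a \<Rightarrow> 'b::countable"
  assumes Y: "Y \<in> measurable M (count_space UNIV)"
  shows "measure_pmf (pmf_distr Y) = distr M (count_space UNIV) Y"
  unfolding pmf_distr_def
proof (rule Abs_pmf_inverse, safe)
  let ?D = "distr M (count_space UNIV) Y"
  interpret D: prob_space ?D by (rule prob_space_distr[OF Y])
  show "prob_space ?D" by unfold_locales
  have "\<exists>S. countable S \<and> (AE x in ?D. x \<in> S)"
    by (intro exI[of _ UNIV]) auto
  then show "AE x in ?D. measure ?D {x} \<noteq> 0"
    by (intro D.AE_support_countable[THEN iffD2]) auto
qed auto

lemma pmf_pmf_distr:
  fixes Y :: "'a \<Rightarrow> 'b::countable"
  assumes Y: "Y \<in> measurable M (count_space UNIV)"
  shows "pmf (pmf_distr Y) t = prob {\<omega> \<in> space M. Y \<omega> = t}"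
  unfolding pmf.rep_eq measure_pmf_distr[OF Y]
  by (subst measure_distr[OF Y]) (auto intro!: arg_cong[where f=prob])

lemma pmf_distr_indep_add:
  fixes Y Z :: "'a \<Rightarrow> int"
  assumes "indep_var (count_space UNIV) Y (count_space UNIV) Z"
  shows "pmf_distr (\<lambda>\<omega>. Y \<omega> + Z \<omega>) = conv_pmf (pmf_distr Y) (pmf_distr Z)"
proof (rule pmf_eqI)
  fix t :: int
  have Y: "Y \<in> measurable M (count_space UNIV)" and Z: "Z \<in> measurable M (count_space UNIV)"
    and prod: "distr M (count_space UNIV) Y \<Otimes>\<^sub>M distr M (count_space UNIV) Z
      = distr M (count_space UNIV \<Otimes>\<^sub>M count_space UNIV) (\<lambda>\<omega>. (Y \<omega>, Z \<omega>))"
    using assms unfolding indep_var_distribution_eq by auto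
  \<comment> \<open>A product of countable discrete spaces is discrete, so the antidiagonal
    \<open>?A\<close> is measurable.\<close>
  have pair: "count_space UNIV \<Otimes>\<^sub>M count_space UNIV = (count_space UNIV :: (int \<times> int) measure)"
    by (subst pair_measure_countable) auto
  let ?A = "{(y, z). y + z = t}"
  have "ennreal (pmf (pmf_distr (\<lambda>\<omega>. Y \<omega> + Z \<omega>)) t)
      = emeasure (distr M (count_space UNIV) (\<lambda>\<omega>. (Y \<omega>, Z \<omega>))) ?A"
    using Y Z measurable_Pair[OF Y Z, unfolded pair]
    by (subst emeasure_distr)
       (auto simp: pmf_pmf_distr[OF measurable_int_add[OF Y Z]] emeasure_eq_measure intro!: arg_cong[where f=prob])
  also have "\<dots> = emeasure (measure_pmf (pmf_distr Y) \<Otimes>\<^sub>M measure_pmf (pmf_distr Z)) ?A"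
    using prod by (simp add: measure_pmf_distr Y Z pair)
  also have "\<dots> = (\<integral>\<^sup>+y. emeasure (pmf_distr Z) (Pair y -` ?A) \<partial>pmf_distr Y)"
  proof (rule measure_pmf.emeasure_pair_measure_alt)
    have "sets (measure_pmf (pmf_distr Y) \<Otimes>\<^sub>M measure_pmf (pmf_distr Z))
        = sets (count_space UNIV \<Otimes>\<^sub>M count_space UNIV :: (int \<times> int) measure)"
      by (intro sets_pair_measure_cong) auto
    then show "?A \<in> sets (measure_pmf (pmf_distr Y) \<Otimes>\<^sub>M measure_pmf (pmf_distr Z))"
      by (simp only: pair) simp
  qed
  also have "\<dots> = (\<integral>\<^sup>+y. ennreal (pmf (pmf_distr Z) (t - y)) \<partial>pmf_distr Y)"
  proof (intro nn_integral_cong)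
    fix y
    have "Pair y -` ?A = {t - y}" by auto
    then show "emeasure (pmf_distr Z) (Pair y -` ?A) = ennreal (pmf (pmf_distr Z) (t - y))"
      by (simp add: emeasure_pmf_single)
  qed
  also have "\<dots> = ennreal (pmf (conv_pmf (pmf_distr Y) (pmf_distr Z)) t)"
    unfolding pmf_conv_pmf_integral
    by (intro nn_integral_eq_integral measure_pmf.integrable_const_bound[where B=1]) (auto simp: pmf_le_1)
  finally show "pmf (pmf_distr (\<lambda>\<omega>. Y \<omega> + Z \<omega>)) t = pmf (conv_pmf (pmf_distr Y) (pmf_distr Z)) t"
    by simp
qed

lemma pmf_distr_iid_sum:
  fixes X :: "nat \<Rightarrow> 'a \<Rightarrow> int"
  assumes ind: "indep_vars (\<lambda>_. count_space UNIV) X {1..}"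
    and id: "\<And>i. 1 \<le> i \<Longrightarrow> distr M (count_space UNIV) (X i) = distr M (count_space UNIV) (X 1)"
  shows "pmf_distr (\<lambda>\<omega>. \<Sum>i=1..n. X i \<omega>) = conv_pow (pmf_distr (X 1)) n"
proof (induction n)
  case 0
  show ?case
    by (rule pmf_eqI) (auto simp: pmf_pmf_distr prob_space indicator_def)
next
  case (Suc n)
  let ?J = "{1..n}" and ?c = "count_space UNIV :: int measure"
  \<comment> \<open>The index blocks \<open>{Suc n}\<close> and \<open>{1..n}\<close> are disjoint,
    so the last variable is independent of every function of the earlier ones, in particular of
    their sum.\<close>
  have "indep_var ?c ((\<lambda>f. f (Suc n)) \<circ> (\<lambda>\<omega>. \<lambda>i\<in>{Suc n}. X i \<omega>))
      ?c ((\<lambda>f. \<Sum>i\<in>?J. f i) \<circ> (\<lambda>\<omega>. \<lambda>i\<in>?J. X i \<omega>))"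
  proof (rule indep_var_compose[OF indep_var_restrict[OF ind]])
    show "(\<lambda>f. \<Sum>i\<in>?J. f i) \<in> measurable (Pi\<^sub>M ?J (\<lambda>_. ?c)) ?c"
      by (intro measurable_int_sum measurable_component_singleton)
  qed auto
  moreover have "(\<lambda>f. f (Suc n)) \<circ> (\<lambda>\<omega>. \<lambda>i\<in>{Suc n}. X i \<omega>) = X (Suc n)" by auto
  moreover have "(\<lambda>f. \<Sum>i\<in>?J. f i) \<circ> (\<lambda>\<omega>. \<lambda>i\<in>?J. X i \<omega>) = (\<lambda>\<omega>. \<Sum>i\<in>?J. X i \<omega>)"
    by (auto simp: fun_eq_iff intro!: sum.cong)
  ultimately have "indep_var ?c (X (Suc n)) ?c (\<lambda>\<omega>. \<Sum>i\<in>?J. X i \<omega>)"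
    by (simp only:)
  then have "pmf_distr (\<lambda>\<omega>. X (Suc n) \<omega> + (\<Sum>i\<in>?J. X i \<omega>))
      = conv_pmf (pmf_distr (X (Suc n))) (pmf_distr (\<lambda>\<omega>. \<Sum>i\<in>?J. X i \<omega>))"
    by (rule pmf_distr_indep_add)
  moreover have "pmf_distr (X (Suc n)) = pmf_distr (X 1)"
    using id[of "Suc n"] by (simp add: pmf_distr_def)
  ultimately show ?case using Suc.IH by (simp add: add.commute)
qed

text \<open>Total probability over the values of \<open>N\<close>. The result is kept as an integral
  over \<open>M\<close>, not as a series, to be ready for dominated convergence.\<close>

lemma prob_random_sum:
  fixes X :: "nat \<Rightarrow> 'a \<Rightarrow> int"
  assumes iid: "iid_with_independent_index M X N"
  shows "prob {\<omega> \<in> space M. random_sum X N \<omega> = t}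
    = (\<integral>\<omega>. pmf (conv_pow (pmf_distr (X 1)) (N \<omega>)) t \<partial>M)"
proof -
  let ?c = "count_space UNIV :: int measure" and ?q = "conv_pow (pmf_distr (X 1))"
  let ?S = "\<lambda>n \<omega>. \<Sum>i=1..n. X i \<omega>"
  have ind: "indep_vars (\<lambda>_. ?c) X {1..}"
    and id: "\<And>i. 1 \<le> i \<Longrightarrow> distr M ?c (X i) = distr M ?c (X 1)"
    and N[measurable]: "N \<in> measurable M (count_space UNIV)"
    and indN: "indep_set (sets (vimage_algebra (space M) N (count_space UNIV)))
       (sets (vimage_algebra (space M) (\<lambda>\<omega>. \<lambda>i\<in>{1..}. X i \<omega>) (Pi\<^sub>M {1..} (\<lambda>_. ?c))))"
    using iid unfolding iid_with_independent_index_def by blast+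
  have X: "X i \<in> measurable M ?c" if "1 \<le> i" for i
    using ind that by (auto simp: indep_vars_def)
  have S[measurable]: "?S n \<in> measurable M ?c" for n by (intro measurable_int_sum X) auto
  have joint: "prob ({\<omega> \<in> space M. N \<omega> = n} \<inter> {\<omega> \<in> space M. ?S n \<omega> = t})
      = prob {\<omega> \<in> space M. N \<omega> = n} * pmf (?q n) t" for n
  proof -
    let ?P = "Pi\<^sub>M {1::nat..} (\<lambda>_. ?c)"
    have 1: "{\<omega> \<in> space M. N \<omega> = n} \<in> sets (vimage_algebra (space M) N (count_space UNIV))"
      using in_vimage_algebra[of "{n}" "count_space UNIV" N "space M"]
      by (simp add: vimage_def Int_def conj_commute)
    have "(\<lambda>f. \<Sum>i=1..n. f i) \<in> measurable ?P ?c"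
      by (intro measurable_int_sum measurable_component_singleton) auto
    from measurable_sets[OF this, of "{t}"]
    have B: "(\<lambda>f. \<Sum>i=1..n. f i) -` {t} \<inter> space ?P \<in> sets ?P" by simp
    \<comment> \<open>The event is expressed through the whole sequence, since independence of
      \<open>N\<close> is given for the sigma-algebra of that sequence.\<close>
    have "{\<omega> \<in> space M. ?S n \<omega> = t}
        = (\<lambda>\<omega>. \<lambda>i\<in>{1..}. X i \<omega>) -` ((\<lambda>f. \<Sum>i=1..n. f i) -` {t} \<inter> space ?P) \<inter> space M"
      by (auto simp: space_PiM cong: sum.cong_simp)
    then have 2: "{\<omega> \<in> space M. ?S n \<omega> = t} \<in> sets (vimage_algebra (space M) (\<lambda>\<omega>. \<lambda>i\<in>{1..}. X i \<omega>) ?P)"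
      using in_vimage_algebra[OF B, of "\<lambda>\<omega>. \<lambda>i\<in>{1..}. X i \<omega>" "space M"] by simp
    show ?thesis
      using indep_setD[OF indN 1 2] pmf_pmf_distr[OF S[of n], of t]
      by (simp only: pmf_distr_iid_sum[OF ind id])
  qed
  have "ennreal (prob {\<omega> \<in> space M. random_sum X N \<omega> = t})
      = emeasure M (\<Union>n. {\<omega> \<in> space M. N \<omega> = n} \<inter> {\<omega> \<in> space M. ?S n \<omega> = t})"
    unfolding emeasure_eq_measure[symmetric] by (intro arg_cong[where f="emeasure M"]) (auto simp: random_sum_def)
  also have "\<dots> = (\<Sum>n. emeasure M ({\<omega> \<in> space M. N \<omega> = n} \<inter> {\<omega> \<in> space M. ?S n \<omega> = t}))"
  proof (rule suminf_emeasure[symmetric])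
    have "{\<omega> \<in> space M. N \<omega> = n} \<inter> {\<omega> \<in> space M. ?S n \<omega> = t} \<in> events" for n by measurable
    then show "range (\<lambda>n. {\<omega> \<in> space M. N \<omega> = n} \<inter> {\<omega> \<in> space M. ?S n \<omega> = t}) \<subseteq> events" by auto
  qed (auto simp: disjoint_family_on_def)
  also have "\<dots> = (\<Sum>n. \<integral>\<^sup>+\<omega>. ennreal (pmf (?q n) t) * indicator {\<omega> \<in> space M. N \<omega> = n} \<omega> \<partial>M)"
    by (simp add: emeasure_eq_measure joint nn_integral_cmult_indicator ennreal_mult' mult.commute del: One_nat_def)
  also have "\<dots> = (\<integral>\<^sup>+\<omega>. (\<Sum>n. ennreal (pmf (?q n) t) * indicator {\<omega> \<in> space M. N \<omega> = n} \<omega>) \<partial>M)"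
    by (rule nn_integral_suminf[symmetric]) measurable
  also have "\<dots> = (\<integral>\<^sup>+\<omega>. ennreal (pmf (?q (N \<omega>)) t) \<partial>M)"
  proof (intro nn_integral_cong)
    fix \<omega> assume "\<omega> \<in> space M"
    then show "(\<Sum>n. ennreal (pmf (?q n) t) * indicator {\<omega> \<in> space M. N \<omega> = n} \<omega>)
        = ennreal (pmf (?q (N \<omega>)) t)"
      by (subst suminf_finite[of "{N \<omega>}"]) auto
  qed
  also have "\<dots> = ennreal (\<integral>\<omega>. pmf (?q (N \<omega>)) t \<partial>M)"
    by (intro nn_integral_eq_integral integrable_const_bound[where B=1]) (auto simp: pmf_le_1)
  finally show ?thesis by (simp add: integral_nonneg_AE)
qed

lemma random_sum_asymp_equiv:
  fixes X :: "nat \<Rightarrow> 'a \<Rightarrow> int"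
  assumes iid: "iid_with_independent_index M X N"
    and tail: "regular_tail (pmf_distr (X 1)) K C \<gamma>"
    and int: "integrable M (\<lambda>\<omega>. real (N \<omega>) powr (1 + \<gamma>))"
  shows "(\<lambda>t. prob {\<omega> \<in> space M. random_sum X N \<omega> = t})
    \<sim>[at_top] (\<lambda>t. (\<integral>\<omega>. real (N \<omega>) \<partial>M) * prob {\<omega> \<in> space M. X 1 \<omega> = t})"
proof -
  let ?p = "pmf_distr (X 1)" and ?E = "\<integral>\<omega>. real (N \<omega>) \<partial>M"
  interpret regular_tail ?p K C \<gamma> by (rule tail)
  have N[measurable]: "N \<in> measurable M (count_space UNIV)"
    and X: "X 1 \<in> measurable M (count_space UNIV)"
    using iid unfolding iid_with_independent_index_def indep_vars_def by (blast, fastforce)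
  have "((\<lambda>t. \<integral>\<omega>. pmf (conv_pow ?p (N \<omega>)) t / pmf ?p t \<partial>M) \<longlongrightarrow> ?E) at_top"
  proof (rule dominated_convergence_at_top_int)
    show "integrable M (\<lambda>\<omega>. C / pmf ?p K * real (N \<omega>) powr (1 + \<gamma>))"
      using int by (rule integrable_mult_right)
    show "\<bar>pmf (conv_pow ?p (N \<omega>)) t / pmf ?p t\<bar> \<le> C / pmf ?p K * real (N \<omega>) powr (1 + \<gamma>)"
      if "K \<le> t" for t \<omega>
      using conv_pow_le[OF that, of "N \<omega>"] tail_pos[OF that] by (simp add: field_simps)
    show "((\<lambda>t. pmf (conv_pow ?p (N \<omega>)) t / pmf ?p t) \<longlongrightarrow> real (N \<omega>)) at_top" for \<omega>
      by (rule conv_pow_tendsto)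
  qed auto
  then have lim: "((\<lambda>t. prob {\<omega> \<in> space M. random_sum X N \<omega> = t} / pmf ?p t) \<longlongrightarrow> ?E) at_top"
    by (simp add: prob_random_sum[OF iid])
  show ?thesis
  proof (cases "?E = 0")
    case False
    have "((\<lambda>t. prob {\<omega> \<in> space M. random_sum X N \<omega> = t} / pmf ?p t / ?E) \<longlongrightarrow> ?E / ?E) at_top"
      using False by (intro tendsto_divide lim tendsto_const)
    then show ?thesis
      using False by (intro asymp_equivI') (simp add: pmf_pmf_distr[OF X, symmetric] field_simps del: One_nat_def)
  next
    case True
    \<comment> \<open>Here the limit of the ratios is 0 and cannot be divided by. Integrability
      comes first, since the integral of a non-integrable function is 0 by default; then
      \<open>N = 0\<close> almost surely, and both sides vanish for \<open>t > 0\<close>.\<close>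
    have "integrable M (\<lambda>\<omega>. real (N \<omega>))"
    proof (rule Bochner_Integration.integrable_bound[OF int], measurable, rule AE_I2)
      fix \<omega>
      show "norm (real (N \<omega>)) \<le> norm (real (N \<omega>) powr (1 + \<gamma>))"
        using powr_mono[of 1 "1 + \<gamma>" "real (N \<omega>)"] \<gamma>_nonneg by (cases "N \<omega> = 0") auto
    qed
    with True have "AE \<omega> in M. N \<omega> = 0"
      by (subst (asm) integral_nonneg_eq_0_iff_AE) auto
    then have *: "(\<integral>\<omega>. pmf (conv_pow ?p (N \<omega>)) t \<partial>M) = 0" if "t > 0" for t
      using that by (subst integral_cong_AE[where g="\<lambda>_. 0"]) auto
    have "eventually (\<lambda>t::int. prob {\<omega> \<in> space M. random_sum X N \<omega> = t} = ?E * prob {\<omega> \<in> space M. X 1 \<omega> = t}) at_top"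
      using eventually_gt_at_top[of 0]
      by eventually_elim (simp only: True prob_random_sum[OF iid] * mult_zero_left)
    then show ?thesis by (rule asymp_equiv_refl_ev)
  qed
qed

end

section \<open>Regularity of the tails in (a) and (b)\<close>

text \<open>With \<open>r = t / k\<close> the power contributes \<open>r powr \<alpha>\<close>, and
  the factor \<open>l\<close> costs at most \<open>C * max (1 / r) r powr \<delta>\<close>. For
  \<open>r \<le> 1\<close> the power absorbs this cost because
  \<open>\<delta> \<le> \<alpha>\<close>; for \<open>r > 1\<close> the exponents add up to
  \<open>\<alpha> + \<delta>\<close>.\<close>

lemma regular_tail_powr:
  fixes p :: "int pmf" and l :: "int \<Rightarrow> real"
  assumes "K > 0" "0 \<le> \<delta>" "\<delta> \<le> \<alpha>"
    and p: "\<And>t. K \<le> t \<Longrightarrow> pmf p t = real_of_int t powr - \<alpha> * l t"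
    and l_pos: "\<And>t. K \<le> t \<Longrightarrow> l t > 0"
    and l_le: "\<And>k t. K \<le> k \<Longrightarrow> K \<le> t \<Longrightarrow>
      l k \<le> C * max (real_of_int k / real_of_int t) (real_of_int t / real_of_int k) powr \<delta> * l t"
    and l_lim: "\<And>k. ((\<lambda>t. l (t - k) / l t) \<longlongrightarrow> 1) at_top"
  shows "regular_tail p K C (\<alpha> + \<delta>)"
proof
  show "pmf p t > 0" if "K \<le> t" for t
    using that \<open>K > 0\<close> l_pos[OF that] by (simp add: p)
next
  fix k t assume k: "K \<le> k" and t: "K \<le> t"
  define r where "r = real_of_int t / real_of_int k"
  have pos: "real_of_int k > 0" "real_of_int t > 0" "r > 0" using k t \<open>K > 0\<close> by (auto simp: r_def)
  have C: "C \<ge> 0" using l_le[of K K] l_pos[of K] \<open>K > 0\<close> by (simp add: mult_le_cancel_right)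
  have r_inv: "real_of_int k / real_of_int t = inverse r" by (simp add: r_def)
  have kt: "real_of_int k powr - \<alpha> = r powr \<alpha> * real_of_int t powr - \<alpha>"
    using pos by (simp add: r_def powr_divide powr_minus field_simps)
  have max_le: "r powr \<alpha> * max (inverse r) r powr \<delta> \<le> max 1 r powr (\<alpha> + \<delta>)"
  proof (cases "r \<le> 1")
    case True
    then have "1 \<le> inverse r" using pos by (simp add: one_le_inverse_iff)
    then have "max (inverse r) r = inverse r" using True by simp
    then have "r powr \<alpha> * max (inverse r) r powr \<delta> = r powr (\<alpha> - \<delta>)"
      using pos by (simp only: powr_diff inverse_powr divide_inverse)
    also have "\<dots> \<le> 1" using True pos \<open>\<delta> \<le> \<alpha>\<close> by (intro powr_le1) auto
    finally show ?thesis using True by simp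
  next
    case False
    then have "inverse r \<le> 1" by (simp add: inverse_le_1_iff)
    then have "max (inverse r) r = r" using False by simp
    then show ?thesis using False by (simp add: powr_add)
  qed
  have "pmf p k \<le> real_of_int k powr - \<alpha> * (C * max (inverse r) r powr \<delta> * l t)"
    unfolding p[OF k] using l_le[OF k t, unfolded r_inv, folded r_def] by (rule mult_left_mono) simp
  also have "\<dots> = C * (r powr \<alpha> * max (inverse r) r powr \<delta>) * pmf p t"
    unfolding kt p[OF t] by simp
  also have "\<dots> \<le> C * max 1 r powr (\<alpha> + \<delta>) * pmf p t"
    using max_le C by (intro mult_right_mono mult_left_mono) auto
  finally show "pmf p k \<le> C * max 1 (real_of_int t / real_of_int k) powr (\<alpha> + \<delta>) * pmf p t"
    by (simp add: r_def)
next
  fix k :: int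
  have "((\<lambda>x. (x - real_of_int k) powr - \<alpha> / x powr - \<alpha>) \<longlongrightarrow> 1) at_top" by real_asymp
  from tendsto_mult[OF filterlim_compose[OF this filterlim_real_of_int_at_top] l_lim[of k]]
  have lim: "((\<lambda>t. (real_of_int t - real_of_int k) powr - \<alpha> / real_of_int t powr - \<alpha> * (l (t - k) / l t)) \<longlongrightarrow> 1) at_top"
    by simp
  have "eventually (\<lambda>t. (real_of_int t - real_of_int k) powr - \<alpha> / real_of_int t powr - \<alpha> * (l (t - k) / l t)
      = pmf p (t - k) / pmf p t) at_top"
    using eventually_ge_at_top[of K] eventually_ge_at_top[of "K + k"]
    by eventually_elim (simp add: p)
  from Lim_transform_eventually[OF lim this]
  show "((\<lambda>t. pmf p (t - k) / pmf p t) \<longlongrightarrow> 1) at_top" .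
qed (use assms in auto)

text \<open>The factor \<open>l\<close> converges to \<open>a > 0\<close>, so it eventually stays
  between \<open>a / 2\<close> and \<open>2 * a\<close>. Its quotients are then below 4, and
  \<open>\<delta> = 0\<close> is possible.\<close>

lemma regular_tail_asymp_powr:
  assumes "0 \<le> \<alpha>" "a > 0" and eq: "(\<lambda>t. pmf p t) \<sim>[at_top] (\<lambda>t. a * real_of_int t powr - \<alpha>)"
  shows "\<exists>K. regular_tail p K 4 \<alpha>"
proof -
  define l where "l t = pmf p t * real_of_int t powr \<alpha>" for t
  have "((\<lambda>t. pmf p t / (a * real_of_int t powr - \<alpha>)) \<longlongrightarrow> 1) at_top"
  proof (rule asymp_equivD_strong[OF eq])
    show "eventually (\<lambda>t. pmf p t \<noteq> 0 \<or> a * real_of_int t powr - \<alpha> \<noteq> 0) at_top"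
      using eventually_gt_at_top[of 0] by eventually_elim (use \<open>a > 0\<close> in auto)
  qed
  from tendsto_mult_right[OF this, of a] have "((\<lambda>t. pmf p t / (a * real_of_int t powr - \<alpha>) * a) \<longlongrightarrow> a) at_top"
    by (simp add: mult.commute)
  moreover have "pmf p t / (a * real_of_int t powr - \<alpha>) * a = l t" for t
    using \<open>a > 0\<close> by (simp add: l_def powr_minus divide_inverse)
  ultimately have lim: "(l \<longlongrightarrow> a) at_top" by simp
  have "eventually (\<lambda>t. a / 2 < l t \<and> l t < 2 * a) at_top"
    using \<open>a > 0\<close> by (intro eventually_conj order_tendstoD[OF lim]) auto
  then obtain K0 where K0: "\<And>t. K0 \<le> t \<Longrightarrow> a / 2 < l t \<and> l t < 2 * a"
    unfolding eventually_at_top_linorder by blast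
  have "regular_tail p (max 1 K0) 4 (\<alpha> + 0)"
  proof (rule regular_tail_powr)
    show "pmf p t = real_of_int t powr - \<alpha> * l t" if "max 1 K0 \<le> t" for t
      using that by (simp add: l_def powr_minus field_simps)
    show "l t > 0" if "max 1 K0 \<le> t" for t
      using K0[of t] that \<open>a > 0\<close> by simp
    \<comment> \<open>Positivity of the base matters because \<open>0 powr 0\<close> is 0, not
      1.\<close>
    have pos: "0 < max (real_of_int k / real_of_int t) (real_of_int t / real_of_int k)"
      if "max 1 K0 \<le> k" "max 1 K0 \<le> t" for k t
      using that by (simp add: less_max_iff_disj)
    show "l k \<le> 4 * max (real_of_int k / real_of_int t) (real_of_int t / real_of_int k) powr 0 * l t"
      if "max 1 K0 \<le> k" "max 1 K0 \<le> t" for k t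
      using K0[of k] K0[of t] pos[OF that] that by simp
    show "((\<lambda>t. l (t - k) / l t) \<longlongrightarrow> 1) at_top" for k
      using tendsto_divide[OF filterlim_compose[OF lim filterlim_int_shift[of k]] lim] \<open>a > 0\<close> by simp
  qed (use \<open>0 \<le> \<alpha>\<close> in auto)
  then show ?thesis by auto
qed

lemma max_divide_swap:
  fixes x y :: real
  assumes "0 < x" "x \<le> y"
  shows "max (x / y) (y / x) = y / x"
proof -
  have "x / y \<le> 1" "1 \<le> y / x" using assms by (auto simp: field_simps)
  then show ?thesis by simp
qed

text \<open>Potter's bound controls the absolute value of the difference of logarithms, so it serves
  for both orders of \<open>k\<close> and \<open>t\<close>; the constant
  \<open>2 powr \<delta>\<close> is the exponential of its slack
  \<open>\<delta> * ln 2\<close>.\<close>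

lemma regular_tail_slowly_varying:
  assumes "0 < \<delta>" "\<delta> \<le> \<alpha>" and sv: "slowly_varying L"
    and p: "\<And>t::int. 1 \<le> t \<Longrightarrow> pmf p t = real_of_int t powr - \<alpha> * L (real_of_int t)"
  shows "\<exists>K. regular_tail p K (2 powr \<delta>) (\<alpha> + \<delta>)"
proof -
  obtain X where X: "X > 0" "\<And>x. X \<le> x \<Longrightarrow> L x > 0"
    and potter: "\<And>x y. X \<le> x \<Longrightarrow> x \<le> y \<Longrightarrow> \<bar>ln (L y) - ln (L x)\<bar> \<le> \<delta> * ln (2 * y / x)"
    using slowly_varying_potter[OF sv \<open>0 < \<delta>\<close>] by blast
  have "regular_tail p (max 1 \<lceil>X\<rceil>) (2 powr \<delta>) (\<alpha> + \<delta>)"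
  proof (rule regular_tail_powr)
    fix k t assume "max 1 \<lceil>X\<rceil> \<le> k" "max 1 \<lceil>X\<rceil> \<le> t"
    then have kt: "X \<le> real_of_int k" "X \<le> real_of_int t" by (auto simp: ceiling_le_iff)
    define m where "m = max (real_of_int k / real_of_int t) (real_of_int t / real_of_int k)"
    have m: "m > 0" using kt X(1) by (simp add: m_def less_max_iff_disj)
    have "ln (L (real_of_int k)) - ln (L (real_of_int t)) \<le> \<delta> * ln (2 * m)"
    proof (cases "k \<le> t")
      case True
      then have "m = real_of_int t / real_of_int k" using kt X(1) by (simp add: m_def max_divide_swap)
      then show ?thesis using potter[of k t] kt True by simp
    next
      case False
      then have "m = real_of_int k / real_of_int t"
        using kt X(1) by (simp add: m_def max_divide_swap max.commute[of "_ / real_of_int t"])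
      then show ?thesis using potter[of t k] kt False by simp
    qed
    then have "ln (L (real_of_int k)) \<le> ln ((2 * m) powr \<delta> * L (real_of_int t))"
      using m X(2)[OF kt(2)] by (simp add: ln_mult ln_powr)
    then have "L (real_of_int k) \<le> (2 * m) powr \<delta> * L (real_of_int t)"
      using m X(2)[OF kt(1)] X(2)[OF kt(2)] by (subst (asm) ln_le_cancel_iff) auto
    also have "\<dots> = 2 powr \<delta> * m powr \<delta> * L (real_of_int t)" using m by (simp add: powr_mult)
    finally show "L (real_of_int k) \<le> 2 powr \<delta> * max (real_of_int k / real_of_int t)
        (real_of_int t / real_of_int k) powr \<delta> * L (real_of_int t)"
      by (simp add: m_def)
  next
    fix k :: int
    show "((\<lambda>t. L (real_of_int (t - k)) / L (real_of_int t)) \<longlongrightarrow> 1) at_top"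
      using filterlim_compose[OF slowly_varying_shift[OF sv, of "- real_of_int k"] filterlim_real_of_int_at_top] by simp
  next
    show "L (real_of_int t) > 0" if "max 1 \<lceil>X\<rceil> \<le> t" for t :: int
      using that by (intro X(2)) (simp add: ceiling_le_iff)
  qed (use assms in auto)
  then show ?thesis by auto
qed

theorem theorem5:
  fixes M :: "'a measure"
    and X :: "nat \<Rightarrow> 'a \<Rightarrow> int"
    and N :: "'a \<Rightarrow> nat"
    and \<alpha> :: real
  assumes "prob_space M"
    and "iid_with_independent_index M X N"
    and "\<alpha> > 1"
  shows "(\<forall>a::real.
            integrable M (\<lambda>\<omega>. real (N \<omega>) powr (1 + \<alpha>)) \<and> a > 0 \<and>
            (\<lambda>t::int. measure M {\<omega> \<in> space M. X 1 \<omega> = t})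
              \<sim>[at_top] (\<lambda>t. a * real_of_int t powr (- \<alpha>))
          \<longrightarrow> (\<lambda>t::int. measure M {\<omega> \<in> space M. random_sum X N \<omega> = t})
              \<sim>[at_top] (\<lambda>t. (\<integral>\<omega>. real (N \<omega>) \<partial>M) * measure M {\<omega> \<in> space M. X 1 \<omega> = t}))
       \<and> (\<forall>(\<beta>::real) (L\<^sub>1::real \<Rightarrow> real).
            \<beta> > 1 + \<alpha> \<and> integrable M (\<lambda>\<omega>. real (N \<omega>) powr \<beta>) \<and>
            slowly_varying L\<^sub>1 \<and>
            (\<forall>t::int. t \<ge> 1 \<longrightarrow>
               measure M {\<omega> \<in> space M. X 1 \<omega> = t} = real_of_int t powr (- \<alpha>) * L\<^sub>1 (real_of_int t))
          \<longrightarrow> (\<lambda>t::int. measure M {\<omega> \<in> space M. random_sum X N \<omega> = t})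
              \<sim>[at_top] (\<lambda>t. (\<integral>\<omega>. real (N \<omega>) \<partial>M) * measure M {\<omega> \<in> space M. X 1 \<omega> = t}))"
proof -
  interpret prob_space M by (rule assms)
  let ?p = "pmf_distr (X 1)"
  have iid: "iid_with_independent_index M X N" by fact
  have N[measurable]: "N \<in> measurable M (count_space UNIV)"
    and X: "X 1 \<in> measurable M (count_space UNIV)"
    using iid unfolding iid_with_independent_index_def indep_vars_def by (blast, fastforce)
  note pmf_X = pmf_pmf_distr[OF X, symmetric]
  show ?thesis
  proof (intro conjI allI impI; elim conjE)
    fix a :: real
    assume int: "integrable M (\<lambda>\<omega>. real (N \<omega>) powr (1 + \<alpha>))" and "a > 0"
      and eq: "(\<lambda>t. prob {\<omega> \<in> space M. X 1 \<omega> = t}) \<sim>[at_top] (\<lambda>t. a * real_of_int t powr - \<alpha>)"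
    obtain K where "regular_tail ?p K 4 \<alpha>"
      using regular_tail_asymp_powr[OF _ \<open>a > 0\<close> eq[unfolded pmf_X]] \<open>\<alpha> > 1\<close> by auto
    from random_sum_asymp_equiv[OF iid this int]
    show "(\<lambda>t. prob {\<omega> \<in> space M. random_sum X N \<omega> = t})
      \<sim>[at_top] (\<lambda>t. expectation (\<lambda>\<omega>. real (N \<omega>)) * prob {\<omega> \<in> space M. X 1 \<omega> = t})" .
  next
    fix \<beta> :: real and L :: "real \<Rightarrow> real"
    assume \<beta>: "\<beta> > 1 + \<alpha>" and int: "integrable M (\<lambda>\<omega>. real (N \<omega>) powr \<beta>)" and sv: "slowly_varying L"
      and eq: "\<forall>t::int. t \<ge> 1 \<longrightarrow> prob {\<omega> \<in> space M. X 1 \<omega> = t} = real_of_int t powr - \<alpha> * L (real_of_int t)"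
    \<comment> \<open>Small enough for \<open>\<delta> \<le> \<alpha>\<close>, and for
      \<open>1 + (\<alpha> + \<delta>) \<le> \<beta>\<close>, so that the given moment
      suffices.\<close>
    define \<delta> where "\<delta> = min \<alpha> (\<beta> - (1 + \<alpha>))"
    have \<delta>: "0 < \<delta>" "\<delta> \<le> \<alpha>" using \<beta> \<open>\<alpha> > 1\<close> by (auto simp: \<delta>_def)
    obtain K where tail: "regular_tail ?p K (2 powr \<delta>) (\<alpha> + \<delta>)"
      using regular_tail_slowly_varying[OF \<delta> sv, of ?p] eq[unfolded pmf_X] by blast
    have "integrable M (\<lambda>\<omega>. real (N \<omega>) powr (1 + (\<alpha> + \<delta>)))"
    proof (rule Bochner_Integration.integrable_bound[OF int], measurable, rule AE_I2)
      fix \<omega>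
      show "norm (real (N \<omega>) powr (1 + (\<alpha> + \<delta>))) \<le> norm (real (N \<omega>) powr \<beta>)"
        \<comment> \<open>Powers increase with the exponent for \<open>N \<ge> 1\<close>; for
          \<open>N = 0\<close> both are 0.\<close>
        using powr_mono[of "1 + (\<alpha> + \<delta>)" \<beta> "real (N \<omega>)"] by (cases "N \<omega> = 0") (auto simp: \<delta>_def)
    qed
    from random_sum_asymp_equiv[OF iid tail this]
    show "(\<lambda>t. prob {\<omega> \<in> space M. random_sum X N \<omega> = t})
      \<sim>[at_top] (\<lambda>t. expectation (\<lambda>\<omega>. real (N \<omega>)) * prob {\<omega> \<in> space M. X 1 \<omega> = t})" .
  qed
qed

end
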